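(* Let $0<\alpha\le 1$, let $L:[a,b]\times\mathbb{R}^n\times\mathbb{R}^n\to\mathbb{R}$ be a $C^2$ function, and consider the fractional integral functional $$I[q(\cdot)]=\frac{1}{\Gamma(\alpha)}\int_a^b L\left(\theta,q(\theta),\dot q(\theta)\right)(t-\theta)^{\alpha-1}\,d\theta .$$ Suppose that $I$ is quasi-invariant up to the gauge term $\Lambda(\theta,q,\dot q)$ under the infinitesimal $\varepsilon$-parameter transformations $$\bar\theta=\theta+\varepsilon\tau(\theta,q)+o(\varepsilon),\qquad \bar q(\bar\theta)=q(\theta)+\varepsilon\xi(\theta,q)+o(\varepsilon),$$ and that the functions $\tau(\theta,q)$ and $\xi(\theta,q)$ satisfy the condition $$L(\theta,q,\dot q)\,\tau(\theta,q)=-\partial_3L(\theta,q,\dot q)\cdot\left(\xi(\theta,q)-\dot q\,\tau(\theta,q)\right).$$ Then $$\partial_3L(\theta,q,\dot q)\cdot\xi(\theta,q)+\left[L(\theta,q,\dot q)-\partial_3L(\theta,q,\dot q)\cdot\dot q\right]\tau(\theta,q)-\Lambda(\theta,q,\dot q)$$ is a constant of motion.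
   Context: Setting. $\Gamma$ is the Euler gamma function, $\theta\in[a,b]$ is the intrinsic time, $t$ is the observer time, a fixed parameter with $t\neq\theta$, and $\dot q=dq/d\theta$. The problem considered is to minimize $I[q(\cdot)]$ under given boundary conditions $q(a)=q_a$, $q(b)=q_b$; the admissible functions $q:[a,b]\to\mathbb{R}^n$ are of class $C^2$. $\partial_iL$ denotes the partial derivative of $L$ with respect to its $i$-th argument, $i=1,2,3$ (so $\partial_2L$, $\partial_3L$ are vectors in $\mathbb{R}^n$), and $\cdot$ is the Euclidean inner product. The function $\tau(\theta,q)$ is real valued, $\xi(\theta,q)$ is $\mathbb{R}^n$-valued, and $\Lambda(\theta,q,\dot q)$ is real valued; they are smooth enough for the total derivatives with respect to $\theta$ of $\tau(\theta,q(\theta))$, $\xi(\theta,q(\theta))$ and $\Lambda(\theta,q(\theta),\dot q(\theta))$ along $C^2$ functions $q(\cdot)$ to exist. Quasi-invariance. The functional $I$ is said to be quasi-invariant under the infinitesimal $\varepsilon$-parameter transformations $\bar\theta=\theta+\varepsilon\tau(\theta,q)+o(\varepsilon)$, $\bar q(\bar\theta)=q(\theta)+\varepsilon\xi(\theta,q)+o(\varepsilon)$ up to the gauge term $\Lambda$ if and only if, along functions $q(\cdot)$ of class $C^2$ and for $\theta\in[a,b]$, $$L\left(\bar\theta,\bar q(\bar\theta),\bar q'(\bar\theta)\right)(t-\bar\theta)^{\alpha-1}\frac{d\bar\theta}{d\theta}=L\left(\theta,q(\theta),\dot q(\theta)\right)(t-\theta)^{\alpha-1}+\varepsilon(t-\theta)^{\alpha-1}\frac{d\Lambda}{d\theta}\left(\theta,q(\theta),\dot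 q(\theta)\right)+o(\varepsilon).$$ Here $\bar q'(\bar\theta)$ is the derivative of $\bar q$ with respect to $\bar\theta$. The $o(\varepsilon)$ terms in the transformations are understood to be differentiable in $\theta$ with derivatives also $o(\varepsilon)$, so that $\frac{d\bar\theta}{d\theta}=1+\varepsilon\dot\tau+o(\varepsilon)$ and $\bar q'(\bar\theta)=\frac{\dot q+\varepsilon\dot\xi+o(\varepsilon)}{1+\varepsilon\dot\tau+o(\varepsilon)}$, where $\dot\tau,\dot\xi$ are the total derivatives with respect to $\theta$ of $\tau(\theta,q(\theta))$, $\xi(\theta,q(\theta))$. Euler-Lagrange equation. The Euler-Lagrange equation of the problem is $$\partial_2L\left(\theta,q(\theta),\dot q(\theta)\right)-\frac{d}{d\theta}\partial_3L\left(\theta,q(\theta),\dot q(\theta)\right)=\frac{1-\alpha}{t-\theta}\,\partial_3L\left(\theta,q(\theta),\dot q(\theta)\right).$$ Constant of motion. A quantity $C(\theta,q(\theta),\dot q(\theta))$, $\theta\in[a,b]$, is a constant of motion if and only if $\frac{d}{d\theta}C(\theta,q(\theta),\dot q(\theta))=0$ for all solutions $q$ of the Euler-Lagrange equation. *)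

theory Defs
  imports "HOL-Analysis.Analysis" "HOL-Library.Landau_Symbols"
begin

text \<open>
  On a set with boundary, such as a compact interval, derivatives are taken within the set;
  at the end points of an interval they are the one-sided ones.
\<close>
definition C2_on :: "'a::real_normed_vector set \<Rightarrow> ('a \<Rightarrow> 'b::real_normed_vector) \<Rightarrow> bool"
  where "C2_on S f \<longleftrightarrow>
    (\<exists>(f' :: 'a \<Rightarrow> 'a \<Rightarrow>\<^sub>L 'b) (f'' :: 'a \<Rightarrow> 'a \<Rightarrow>\<^sub>L 'a \<Rightarrow>\<^sub>L 'b).
       (\<forall>x\<in>S. (f has_derivative blinfun_apply (f' x)) (at x within S)) \<and>
       (\<forall>x\<in>S. (f' has_derivative blinfun_apply (f'' x)) (at x within S)) \<and>
       continuous_on S f'')"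

definition gradient :: "('a::real_inner \<Rightarrow> real) \<Rightarrow> 'a \<Rightarrow> 'a"
  where "gradient f x = (THE D. GDERIV f x :> D)"

lemma gradient_eqI: "GDERIV f x :> D \<Longrightarrow> gradient f x = D"
  unfolding gradient_def gderiv_def
  by (rule the_equality)
    (assumption, metis has_derivative_unique inner_commute vector_eq_rdot)

definition partial2 :: "(real \<Rightarrow> 'a::real_inner \<Rightarrow> 'a \<Rightarrow> real) \<Rightarrow> real \<Rightarrow> 'a \<Rightarrow> 'a \<Rightarrow> 'a"
  where "partial2 L \<theta> x v = gradient (\<lambda>y. L \<theta> y v) x"

definition partial3 :: "(real \<Rightarrow> 'a::real_inner \<Rightarrow> 'a \<Rightarrow> real) \<Rightarrow> real \<Rightarrow> 'a \<Rightarrow> 'a \<Rightarrow> 'a"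
  where "partial3 L \<theta> x v = gradient (\<lambda>w. L \<theta> x w) v"

text \<open>The derivative in \<open>\<theta>\<close> of a function on \<open>[a, b]\<close>.\<close>
definition ddt :: "real \<Rightarrow> real \<Rightarrow> (real \<Rightarrow> 'v::real_normed_vector) \<Rightarrow> real \<Rightarrow> 'v"
  where "ddt a b f \<theta> = vector_derivative f (at \<theta> within {a..b})"

text \<open>
  For a negative base the real power satisfies \<open>x powr c = \<bar>x\<bar> powr c\<close>. Hence for \<open>t < a\<close> the
  weight \<open>(t - \<theta>) powr (\<alpha> - 1)\<close> is \<open>\<bar>t - \<theta>\<bar> powr (\<alpha> - 1)\<close>, which differs from the principal
  complex power only by a constant factor of modulus 1. For \<open>t > b\<close> it is the usual power.
\<close>
definition fractional_density ::
    "real \<Rightarrow> real \<Rightarrow> (real \<Rightarrow> 'a \<Rightarrow> 'a \<Rightarrow> real) \<Rightarrow> real \<Rightarrow> 'a \<Rightarrow> 'a \<Rightarrow> real"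
  where "fractional_density \<alpha> t L \<theta> x v = L \<theta> x v * (t - \<theta>) powr (\<alpha> - 1)"

definition fractional_action ::
    "real \<Rightarrow> real \<Rightarrow> real \<Rightarrow> real \<Rightarrow> (real \<Rightarrow> 'a \<Rightarrow> 'a \<Rightarrow> real)
      \<Rightarrow> (real \<Rightarrow> 'a::real_normed_vector) \<Rightarrow> real"
  where "fractional_action a b \<alpha> t L q =
    1 / Gamma \<alpha> * integral {a..b} (\<lambda>\<theta>. fractional_density \<alpha> t L \<theta> (q \<theta>) (ddt a b q \<theta>))"

text \<open>
  A term \<open>r \<epsilon> \<theta>\<close> that is \<open>o(\<epsilon>)\<close> as \<open>\<epsilon> \<rightarrow> 0\<close> together with its derivative in \<open>\<theta>\<close>;
  no uniformity in \<open>\<theta>\<close> is required.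
\<close>
definition negligible_term ::
    "real \<Rightarrow> real \<Rightarrow> (real \<Rightarrow> real \<Rightarrow> 'v::real_normed_vector) \<Rightarrow> bool"
  where "negligible_term a b r \<longleftrightarrow>
    (\<forall>\<theta>\<in>{a..b}.
       (\<forall>\<^sub>F \<epsilon> in at 0. r \<epsilon> differentiable (at \<theta> within {a..b})) \<and>
       (\<lambda>\<epsilon>. norm (r \<epsilon> \<theta>)) \<in> o[at 0](\<lambda>\<epsilon>. \<epsilon>) \<and>
       (\<lambda>\<epsilon>. norm (ddt a b (r \<epsilon>) \<theta>)) \<in> o[at 0](\<lambda>\<epsilon>. \<epsilon>))"

text \<open>
  For a curve \<open>q\<close>, the transformed time \<open>T q \<epsilon> \<theta>\<close> is \<open>\<theta>bar\<close> and \<open>X q \<epsilon> \<theta>\<close> is \<open>qbar(\<theta>bar)\<close>, i.e.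
  \<open>qbar\<close> parametrised by the old time \<open>\<theta>\<close>. The \<open>o(\<epsilon>)\<close> terms may depend on the whole curve, which
  includes the case that they are functions of \<open>(\<epsilon>, \<theta>, q(\<theta>))\<close> only.
\<close>
definition infinitesimal_transformation ::
    "real \<Rightarrow> real \<Rightarrow> (real \<Rightarrow> 'a::real_normed_vector \<Rightarrow> real) \<Rightarrow> (real \<Rightarrow> 'a \<Rightarrow> 'a)
      \<Rightarrow> ((real \<Rightarrow> 'a) \<Rightarrow> real \<Rightarrow> real \<Rightarrow> real) \<Rightarrow> ((real \<Rightarrow> 'a) \<Rightarrow> real \<Rightarrow> real \<Rightarrow> 'a) \<Rightarrow> bool"
  where "infinitesimal_transformation a b \<tau> \<xi> T X \<longleftrightarrow>
    (\<forall>q. C2_on {a..b} q \<longrightarrow>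
       negligible_term a b (\<lambda>\<epsilon> \<theta>. T q \<epsilon> \<theta> - (\<theta> + \<epsilon> * \<tau> \<theta> (q \<theta>))) \<and>
       negligible_term a b (\<lambda>\<epsilon> \<theta>. X q \<epsilon> \<theta> - (q \<theta> + \<epsilon> *\<^sub>R \<xi> \<theta> (q \<theta>))))"

text \<open>
  Quasi-invariance of the functional \<open>fractional_action a b \<alpha> t L\<close> is a condition on its density.
  The derivative of \<open>qbar\<close> with respect to \<open>\<theta>bar\<close> is \<open>(dX/d\<theta>) / (dT/d\<theta>)\<close>. Since the Lagrangian is
  given only for times in \<open>[a, b]\<close>, the limit \<open>\<epsilon> \<rightarrow> 0\<close> is restricted to those \<open>\<epsilon>\<close> for which the
  transformed time lies in \<open>[a, b]\<close>; where \<open>\<theta>\<close> is interior this is no restriction.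
\<close>
definition quasi_invariant ::
    "real \<Rightarrow> real \<Rightarrow> real \<Rightarrow> real \<Rightarrow> (real \<Rightarrow> 'a::real_normed_vector \<Rightarrow> 'a \<Rightarrow> real)
      \<Rightarrow> (real \<Rightarrow> 'a \<Rightarrow> 'a \<Rightarrow> real)
      \<Rightarrow> ((real \<Rightarrow> 'a) \<Rightarrow> real \<Rightarrow> real \<Rightarrow> real) \<Rightarrow> ((real \<Rightarrow> 'a) \<Rightarrow> real \<Rightarrow> real \<Rightarrow> 'a) \<Rightarrow> bool"
  where "quasi_invariant a b \<alpha> t L \<Lambda> T X \<longleftrightarrow>
    (\<forall>q. C2_on {a..b} q \<longrightarrow> (\<forall>\<theta>\<in>{a..b}.
       (\<lambda>\<epsilon>. fractional_density \<alpha> t L (T q \<epsilon> \<theta>) (X q \<epsilon> \<theta>)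
                (ddt a b (X q \<epsilon>) \<theta> /\<^sub>R ddt a b (T q \<epsilon>) \<theta>) * ddt a b (T q \<epsilon>) \<theta>
            - (fractional_density \<alpha> t L \<theta> (q \<theta>) (ddt a b q \<theta>)
               + \<epsilon> * (t - \<theta>) powr (\<alpha> - 1) * ddt a b (\<lambda>s. \<Lambda> s (q s) (ddt a b q s)) \<theta>))
       \<in> o[at 0 within {\<epsilon>. T q \<epsilon> \<theta> \<in> {a..b}}](\<lambda>\<epsilon>. \<epsilon>)))"

definition euler_lagrange_solution ::
    "real \<Rightarrow> real \<Rightarrow> real \<Rightarrow> real \<Rightarrow> (real \<Rightarrow> 'a::real_inner \<Rightarrow> 'a \<Rightarrow> real) \<Rightarrow> (real \<Rightarrow> 'a) \<Rightarrow> bool"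
  where "euler_lagrange_solution a b \<alpha> t L q \<longleftrightarrow>
    C2_on {a..b} q \<and>
    (\<forall>\<theta>\<in>{a..b}.
       partial2 L \<theta> (q \<theta>) (ddt a b q \<theta>)
         - ddt a b (\<lambda>s. partial3 L s (q s) (ddt a b q s)) \<theta>
       = ((1 - \<alpha>) / (t - \<theta>)) *\<^sub>R partial3 L \<theta> (q \<theta>) (ddt a b q \<theta>))"

definition constant_of_motion ::
    "real \<Rightarrow> real \<Rightarrow> real \<Rightarrow> real \<Rightarrow> (real \<Rightarrow> 'a::real_inner \<Rightarrow> 'a \<Rightarrow> real)
      \<Rightarrow> (real \<Rightarrow> 'a \<Rightarrow> 'a \<Rightarrow> real) \<Rightarrow> bool"
  where "constant_of_motion a b \<alpha> t L C \<longleftrightarrow>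
    (\<forall>q. euler_lagrange_solution a b \<alpha> t L q \<longrightarrow>
       (\<forall>\<theta>\<in>{a..b}.
          ((\<lambda>s. C s (q s) (ddt a b q s)) has_real_derivative 0) (at \<theta> within {a..b})))"

end

theory Submission
  imports Defs
begin

text \<open>
  Write \<open>p\<close> for the momentum \<open>partial3 L\<close> along a curve \<open>q\<close> and \<open>v\<close> for its velocity. The condition
  on \<open>\<tau>\<close> and \<open>\<xi>\<close> says that \<open>N = p \<bullet> (\<xi> - \<tau> v) + L \<tau>\<close> vanishes identically, and the claimed constant
  of motion is \<open>N - \<Lambda>\<close>. So what has to be shown is that the gauge term \<open>\<Lambda>\<close> does not
  change along a solution of the Euler-Lagrange equation.

  Comparing the coefficients of \<open>\<epsilon>\<close> in quasi-invariance and cancelling the weight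
  \<open>(t - \<theta>) powr (\<alpha> - 1)\<close> gives the first variation identity
  \<open>\<partial>\<^sub>1L \<tau> + \<partial>\<^sub>2L \<bullet> \<xi> + p \<bullet> (\<xi>' - \<tau>' v) + L (\<tau>' + k \<tau>) = \<Lambda>'\<close> with \<open>k = (1 - \<alpha>) / (t - \<theta>)\<close>,
  where a prime is the total derivative in \<open>\<theta>\<close> (lemma \<open>quasi_invariant_first_variation\<close>).
  On the other hand, differentiating \<open>N\<close> along a solution, with \<open>p' = \<partial>\<^sub>2L - k p\<close>, gives
  \<open>N' = \<Lambda>' - k (L \<tau> + p \<bullet> (\<xi> - \<tau> v)) = \<Lambda>' - k N\<close>: the friction caused by the weight is proportional
  to \<open>N\<close>. Since \<open>N = 0\<close>, this yields \<open>\<Lambda>' = 0\<close> (lemma \<open>gauge_rate_vanishes\<close>).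

  The argument works at interior times only. At an end point the transformed time may leave
  \<open>[a, b]\<close> for every small \<open>\<epsilon>\<close>, and quasi-invariance is then empty. But \<open>\<Lambda>\<close> is continuous along
  the curve, hence constant on all of \<open>[a, b]\<close>, and its one-sided derivatives at the end points
  vanish as well.
\<close>

section \<open>Derivatives along curves\<close>

lemma ddt_eqI:
  assumes "a < b" "s \<in> {a..b}" "(f has_vector_derivative d) (at s within {a..b})"
  shows "ddt a b f s = d"
  using vector_derivative_within_cbox[of a b s f d] assms unfolding ddt_def
  by simp

lemma has_vector_derivative_ddt:
  assumes "f differentiable (at s within {a..b})"
  shows "(f has_vector_derivative ddt a b f s) (at s within {a..b})"
  using assms unfolding ddt_def by (simp add: vector_derivative_works)

text \<open>
  A \<open>C2\<close> curve comes with some field of derivatives. Derivatives within a non-degenerate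
  interval are unique, so this field is \<open>ddt\<close>, which is therefore differentiable itself.
\<close>
lemma C2_on_interval_velocity:
  assumes "a < b" "C2_on {a..b} q" "s \<in> {a..b}"
  shows "(q has_vector_derivative ddt a b q s) (at s within {a..b})"
    and "ddt a b q differentiable (at s within {a..b})"
proof -
  obtain q' :: "real \<Rightarrow> real \<Rightarrow>\<^sub>L 'a" and q'' :: "real \<Rightarrow> real \<Rightarrow>\<^sub>L real \<Rightarrow>\<^sub>L 'a"
    where q': "\<And>r. r \<in> {a..b} \<Longrightarrow> (q has_derivative q' r) (at r within {a..b})"
      and q'': "\<And>r. r \<in> {a..b} \<Longrightarrow> (q' has_derivative q'' r) (at r within {a..b})"
    using assms(2) unfolding C2_on_def by blast
  have vel: "(q has_vector_derivative q' r 1) (at r within {a..b})" if "r \<in> {a..b}" for r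
    using q'[OF that] unfolding has_vector_derivative_def
    by (simp flip: blinfun.scaleR_right)
  have ddt: "ddt a b q r = q' r 1" if "r \<in> {a..b}" for r
    using ddt_eqI[OF assms(1) that vel[OF that]] .
  show "(q has_vector_derivative ddt a b q s) (at s within {a..b})"
    using vel[OF assms(3)] ddt[OF assms(3)] by simp
  have "((\<lambda>r. q' r 1) has_derivative (\<lambda>h. q'' s h 1)) (at s within {a..b})"
    using bounded_linear.has_derivative[OF blinfun.bounded_linear_left q''[OF assms(3)]] .
  then have "(ddt a b q has_derivative (\<lambda>h. q'' s h 1)) (at s within {a..b})"
    by (rule has_derivative_transform[OF assms(3), rotated]) (simp add: ddt)
  then show "ddt a b q differentiable (at s within {a..b})"
    unfolding differentiable_def by blast
qed

lemma gradient_inner: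
  fixes f :: "'a::euclidean_space \<Rightarrow> real"
  assumes "(f has_derivative D) (at x)"
  shows "gradient f x \<bullet> u = D u"
proof -
  have lin: "linear D"
    using assms by (simp add: has_derivative_linear)
  have D: "D = (\<lambda>h. h \<bullet> adjoint D 1)"
    using adjoint_works[OF lin, of _ 1] by (auto simp: fun_eq_iff)
  have "GDERIV f x :> adjoint D 1"
    unfolding gderiv_def by (subst D[symmetric]) (rule assms)
  then have "gradient f x = adjoint D 1"
    by (rule gradient_eqI)
  then show ?thesis
    using adjoint_works[OF lin, of u 1] by (simp add: inner_commute)
qed

text \<open>
  The slices of the domain in the second and third argument are whole spaces, so the restriction of
  the time to \<open>I\<close> does not affect the two gradients, even at the end points of an interval.
\<close>
lemma partial_inner:
  fixes L :: "real \<Rightarrow> 'a::euclidean_space \<Rightarrow> 'a \<Rightarrow> real"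
  assumes D: "((\<lambda>(\<theta>, x, v). L \<theta> x v) has_derivative D)
                (at (\<theta>, x, v) within I \<times> UNIV \<times> UNIV)"
    and "\<theta> \<in> I"
  shows "partial2 L \<theta> x v \<bullet> u = D (0, u, 0)"
    and "partial3 L \<theta> x v \<bullet> u = D (0, 0, u)"
proof -
  have "((\<lambda>y. (\<lambda>(\<theta>, x, v). L \<theta> x v) (\<theta>, y, v)) has_derivative (\<lambda>h. D (0, h, 0))) (at x)"
  proof (rule has_derivative_in_compose[where f = "\<lambda>y. (\<theta>, y, v)"])
    show "((\<lambda>y. (\<theta>, y, v)) has_derivative (\<lambda>h. (0, h, 0))) (at x)"
      by (auto intro!: derivative_eq_intros)
    show "((\<lambda>(\<theta>, x, v). L \<theta> x v) has_derivative D) (at (\<theta>, x, v) within range (\<lambda>y. (\<theta>, y, v)))"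
      using assms(2) by (intro has_derivative_subset[OF D]) auto
  qed
  then show "partial2 L \<theta> x v \<bullet> u = D (0, u, 0)"
    unfolding partial2_def by (simp add: gradient_inner)
  have "((\<lambda>w. (\<lambda>(\<theta>, x, v). L \<theta> x v) (\<theta>, x, w)) has_derivative (\<lambda>h. D (0, 0, h))) (at v)"
  proof (rule has_derivative_in_compose[where f = "\<lambda>w. (\<theta>, x, w)"])
    show "((\<lambda>w. (\<theta>, x, w)) has_derivative (\<lambda>h. (0, 0, h))) (at v)"
      by (auto intro!: derivative_eq_intros)
    show "((\<lambda>(\<theta>, x, v). L \<theta> x v) has_derivative D) (at (\<theta>, x, v) within range (\<lambda>w. (\<theta>, x, w)))"
      using assms(2) by (intro has_derivative_subset[OF D]) auto
  qed
  then show "partial3 L \<theta> x v \<bullet> u = D (0, 0, u)"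
    unfolding partial3_def by (simp add: gradient_inner)
qed

text \<open>
  The derivative \<open>ddt\<close> of the momentum in the Euler-Lagrange equation is meaningful only if the
  momentum is differentiable along the curve. It is, because its coordinates are
  values of the derivative of \<open>L\<close>, which is once more differentiable.
\<close>
lemma momentum_differentiable_along_curve:
  fixes L :: "real \<Rightarrow> 'a::euclidean_space \<Rightarrow> 'a \<Rightarrow> real"
  assumes L: "C2_on (I \<times> UNIV \<times> UNIV) (\<lambda>(\<theta>, x, v). L \<theta> x v)"
    and "q differentiable (at s within I)" "u differentiable (at s within I)" "s \<in> I"
  shows "(\<lambda>r. partial3 L r (q r) (u r)) differentiable (at s within I)"
proof -
  let ?S = "I \<times> (UNIV :: 'a set) \<times> (UNIV :: 'a set)"
  obtain L' :: "real \<times> 'a \<times> 'a \<Rightarrow> (real \<times> 'a \<times> 'a) \<Rightarrow>\<^sub>L real" and L''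
    where L': "\<And>z. z \<in> ?S \<Longrightarrow> ((\<lambda>(\<theta>, x, v). L \<theta> x v) has_derivative blinfun_apply (L' z)) (at z within ?S)"
      and L'': "\<And>z. z \<in> ?S \<Longrightarrow> (L' has_derivative blinfun_apply (L'' z)) (at z within ?S)"
    using L unfolding C2_on_def by blast
  have p: "partial3 L r (q r) (u r) = (\<Sum>i\<in>Basis. L' (r, q r, u r) (0, 0, i) *\<^sub>R i)" if "r \<in> I" for r
    using partial_inner(2)[OF L'[of "(r, q r, u r)"]] that
    by (subst euclidean_representation[symmetric]) simp
  obtain dq du where "(q has_derivative dq) (at s within I)" "(u has_derivative du) (at s within I)"
    using assms(2,3) unfolding differentiable_def by blast
  then have z: "((\<lambda>r. (r, q r, u r)) has_derivative (\<lambda>h. (h, dq h, du h))) (at s within I)"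
    by (intro has_derivative_Pair has_derivative_ident)
  have "((\<lambda>r. L' (r, q r, u r)) has_derivative (\<lambda>h. L'' (s, q s, u s) (h, dq h, du h)))
      (at s within I)"
  proof (rule has_derivative_in_compose[OF z])
    show "(L' has_derivative L'' (s, q s, u s)) (at (s, q s, u s) within (\<lambda>r. (r, q r, u r)) ` I)"
      by (rule has_derivative_subset[OF L'']) (use \<open>s \<in> I\<close> in auto)
  qed
  then have "((\<lambda>r. \<Sum>i\<in>Basis. L' (r, q r, u r) (0, 0, i) *\<^sub>R i) has_derivative
      (\<lambda>h. \<Sum>i\<in>Basis. L'' (s, q s, u s) (h, dq h, du h) (0, 0, i) *\<^sub>R i)) (at s within I)"
    by (intro has_derivative_sum has_derivative_scaleR_left
        bounded_linear.has_derivative[OF blinfun.bounded_linear_left])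
  then have "((\<lambda>r. partial3 L r (q r) (u r)) has_derivative
      (\<lambda>h. \<Sum>i\<in>Basis. L'' (s, q s, u s) (h, dq h, du h) (0, 0, i) *\<^sub>R i)) (at s within I)"
    by (rule has_derivative_transform[OF \<open>s \<in> I\<close>, rotated]) (rule p)
  then show ?thesis
    unfolding differentiable_def by blast
qed

section \<open>Differentiating in the parameter of the transformation\<close>

text \<open>
  The transformed quantities are controlled for \<open>\<epsilon> \<rightarrow> 0\<close>, while their values at \<open>\<epsilon> = 0\<close> are
  arbitrary. Overwriting the value at \<open>0\<close> by the intended limit turns a first-order expansion
  into a derivative, so that the chain rule and the uniqueness of derivatives apply.
\<close>
lemma has_vector_derivative_of_smallo:
  fixes F :: "real \<Rightarrow> 'v::real_normed_vector"
  assumes "(\<lambda>\<epsilon>. norm (F \<epsilon> - (c + \<epsilon> *\<^sub>R d))) \<in> o[at 0](\<lambda>\<epsilon>. \<epsilon>)"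
  shows "(F(0 := c) has_vector_derivative d) (at 0)"
proof -
  have "((\<lambda>\<epsilon>. norm (norm (F \<epsilon> - (c + \<epsilon> *\<^sub>R d)) / \<epsilon>)) \<longlongrightarrow> 0) (at 0)"
    using smalloD_tendsto[OF assms] by (rule tendsto_norm_zero)
  then have "((\<lambda>\<epsilon>. norm ((F(0 := c)) \<epsilon> - (F(0 := c)) 0 - (\<epsilon> - 0) *\<^sub>R d) / norm (\<epsilon> - 0)) \<longlongrightarrow> 0) (at 0)"
    by (rule Lim_transform_eventually)
      (auto simp: eventually_at_filter algebra_simps intro!: always_eventually)
  then show ?thesis
    unfolding has_vector_derivative_def has_derivative_iff_norm
    by (simp add: bounded_linear_scaleR_left)
qed

text \<open>
  The formula is the same on both sides of \<open>t\<close>, because a real power does not depend on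
  the sign of its base.
\<close>
lemma weight_has_derivative:
  fixes t \<theta> c :: real
  assumes "\<theta> \<noteq> t"
  shows "((\<lambda>s. (t - s) powr c) has_real_derivative (- c / (t - \<theta>)) * (t - \<theta>) powr c) (at \<theta>)"
proof -
  \<comment> \<open>The factor \<open>k\<close> is a sign that makes the base of the power positive.\<close>
  have pos: "((\<lambda>s. (k * (t - s)) powr c) has_real_derivative
      (- c / (t - \<theta>)) * (k * (t - \<theta>)) powr c) (at \<theta>)" if "k * (t - \<theta>) > 0" for k
  proof -
    have "((\<lambda>s. k * (t - s)) has_real_derivative - k) (at \<theta>)"
      by (auto intro!: derivative_eq_intros)
    from DERIV_fun_powr[OF this that, of c] show ?thesis
      using that by (cases "k = 0") (simp_all add: powr_diff)
  qed
  show ?thesis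
  proof (cases "\<theta> < t")
    case True
    then show ?thesis
      using pos[of 1] by simp
  next
    case False
    have "((\<lambda>s. (- (t - s)) powr c) has_real_derivative
        (- c / (t - \<theta>)) * (- (t - \<theta>)) powr c) (at \<theta>)"
      using pos[of "- 1"] False assms by simp
    then show ?thesis
      unfolding uminus_powr_eq .
  qed
qed

text \<open>
  Here \<open>S\<close> and \<open>W\<close> stand for the derivatives in the old time of the transformed time \<open>T\<close> and position
  \<open>X\<close>. The transformed velocity is \<open>W / S\<close>, whose rate of change at \<open>\<epsilon> = 0\<close> is \<open>\<omega> - \<sigma> v\<close>. The
  term \<open>(1 - \<alpha>) / (t - \<theta>) * \<tau>\<close> comes from the weight, the term \<open>\<sigma>\<close> beside it from the
  change of the time element.
\<close>
lemma transformed_density_has_derivative: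
  fixes L :: "real \<Rightarrow> 'a::euclidean_space \<Rightarrow> 'a \<Rightarrow> real"
  assumes D: "((\<lambda>(\<theta>, x, v). L \<theta> x v) has_derivative D) (at (\<theta>, x, v))" and "\<theta> \<noteq> t"
    and T: "(T has_vector_derivative \<tau>) (at 0)" "T 0 = \<theta>"
    and X: "(X has_vector_derivative \<xi>) (at 0)" "X 0 = x"
    and S: "(S has_vector_derivative \<sigma>) (at 0)" "S 0 = 1"
    and W: "(W has_vector_derivative \<omega>) (at 0)" "W 0 = v"
  shows "((\<lambda>\<epsilon>. fractional_density \<alpha> t L (T \<epsilon>) (X \<epsilon>) (W \<epsilon> /\<^sub>R S \<epsilon>) * S \<epsilon>) has_real_derivative
           (t - \<theta>) powr (\<alpha> - 1)
             * (D (\<tau>, \<xi>, \<omega> - \<sigma> *\<^sub>R v) + L \<theta> x v * (\<sigma> + (1 - \<alpha>) / (t - \<theta>) * \<tau>))) (at 0)"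
proof -
  interpret D: bounded_linear D
    using D by (rule has_derivative_bounded_linear)
  have "((\<lambda>\<epsilon>. (T \<epsilon>, X \<epsilon>, W \<epsilon> /\<^sub>R S \<epsilon>)) has_derivative (\<lambda>h. h *\<^sub>R (\<tau>, \<xi>, \<omega> - \<sigma> *\<^sub>R v))) (at 0)"
    using T X S W unfolding has_vector_derivative_def
    by (auto intro!: derivative_eq_intros simp: algebra_simps)
  then have "((\<lambda>\<epsilon>. (\<lambda>(\<theta>, x, v). L \<theta> x v) (T \<epsilon>, X \<epsilon>, W \<epsilon> /\<^sub>R S \<epsilon>)) has_derivative
      (\<lambda>h. D (h *\<^sub>R (\<tau>, \<xi>, \<omega> - \<sigma> *\<^sub>R v)))) (at 0)"
    by (rule has_derivative_compose[where g = "\<lambda>(\<theta>, x, v). L \<theta> x v"])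
      (simp add: D T(2) X(2) S(2) W(2))
  then have *: "((\<lambda>\<epsilon>. L (T \<epsilon>) (X \<epsilon>) (W \<epsilon> /\<^sub>R S \<epsilon>)) has_real_derivative
      D (\<tau>, \<xi>, \<omega> - \<sigma> *\<^sub>R v)) (at 0)"
    by (simp add: D.scaleR has_field_derivative_def mult_commute_abs del: scaleR_Pair)
  have "((\<lambda>\<epsilon>. (t - T \<epsilon>) powr (\<alpha> - 1)) has_real_derivative
      (1 - \<alpha>) / (t - \<theta>) * (t - \<theta>) powr (\<alpha> - 1) * \<tau>) (at 0)"
    using DERIV_chain2[where g = T and x = 0, OF weight_has_derivative[of "T 0" t "\<alpha> - 1"], of \<tau> UNIV] T \<open>\<theta> \<noteq> t\<close>
    by (simp add: has_real_derivative_iff_has_vector_derivative)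
  from DERIV_mult[OF DERIV_mult[OF * this] S(1)[folded has_real_derivative_iff_has_vector_derivative]]
  show ?thesis
    unfolding fractional_density_def using S T X W by (simp add: algebra_simps)
qed

lemma negligible_term_first_order:
  fixes F :: "real \<Rightarrow> real \<Rightarrow> 'v::real_normed_vector"
  assumes "a < b" and r: "negligible_term a b (\<lambda>\<epsilon> s. F \<epsilon> s - (f s + \<epsilon> *\<^sub>R g s))"
    and "\<theta> \<in> {a..b}"
    and f: "(f has_vector_derivative f') (at \<theta> within {a..b})"
    and g: "g differentiable (at \<theta> within {a..b})"
  shows "((\<lambda>\<epsilon>. F \<epsilon> \<theta>)(0 := f \<theta>) has_vector_derivative g \<theta>) (at 0)"
    and "((\<lambda>\<epsilon>. ddt a b (F \<epsilon>) \<theta>)(0 := f') has_vector_derivative ddt a b g \<theta>) (at 0)"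
proof -
  let ?r = "\<lambda>\<epsilon> s. F \<epsilon> s - (f s + \<epsilon> *\<^sub>R g s)"
  show "((\<lambda>\<epsilon>. F \<epsilon> \<theta>)(0 := f \<theta>) has_vector_derivative g \<theta>) (at 0)"
    using r \<open>\<theta> \<in> {a..b}\<close> unfolding negligible_term_def
    by (intro has_vector_derivative_of_smallo) blast
  \<comment> \<open>The derivative in \<open>\<theta>\<close> splits only for those \<open>\<epsilon>\<close> for which the remainder is differentiable;
      these are all \<open>\<epsilon>\<close> near \<open>0\<close>.\<close>
  have "ddt a b (F \<epsilon>) \<theta> = ddt a b (?r \<epsilon>) \<theta> + (f' + \<epsilon> *\<^sub>R ddt a b g \<theta>)"
    if "?r \<epsilon> differentiable (at \<theta> within {a..b})" for \<epsilon>
  proof (rule ddt_eqI[OF \<open>a < b\<close> \<open>\<theta> \<in> {a..b}\<close>])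
    have "((\<lambda>s. ?r \<epsilon> s + (f s + \<epsilon> *\<^sub>R g s)) has_vector_derivative
        ddt a b (?r \<epsilon>) \<theta> + (f' + \<epsilon> *\<^sub>R ddt a b g \<theta>)) (at \<theta> within {a..b})"
      by (intro has_vector_derivative_add has_vector_derivative_ddt[OF that] f
          bounded_linear.has_vector_derivative[OF bounded_linear_scaleR_right]
          has_vector_derivative_ddt[OF g])
    then show "(F \<epsilon> has_vector_derivative
        ddt a b (?r \<epsilon>) \<theta> + (f' + \<epsilon> *\<^sub>R ddt a b g \<theta>)) (at \<theta> within {a..b})"
      by simp
  qed
  then have "\<forall>\<^sub>F \<epsilon> in at 0. norm (ddt a b (F \<epsilon>) \<theta> - (f' + \<epsilon> *\<^sub>R ddt a b g \<theta>)) = norm (ddt a b (?r \<epsilon>) \<theta>)"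
    using r \<open>\<theta> \<in> {a..b}\<close> unfolding negligible_term_def
    by (fastforce elim: eventually_mono)
  then show "((\<lambda>\<epsilon>. ddt a b (F \<epsilon>) \<theta>)(0 := f') has_vector_derivative ddt a b g \<theta>) (at 0)"
    using r \<open>\<theta> \<in> {a..b}\<close> unfolding negligible_term_def
    by (intro has_vector_derivative_of_smallo) (simp add: landau_o.small.in_cong)
qed

text \<open>
  Quasi-invariance and the chain rule both give the derivative at \<open>\<epsilon> = 0\<close> of the transformed density.
  They agree, and the weight, which is not zero, cancels.
\<close>
lemma quasi_invariant_first_variation:
  fixes L :: "real \<Rightarrow> 'a::euclidean_space \<Rightarrow> 'a \<Rightarrow> real"
  assumes "a < b" "\<theta> \<in> {a<..<b}" "t \<notin> {a..b}" and q: "C2_on {a..b} q"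
    and D: "((\<lambda>(\<theta>, x, v). L \<theta> x v) has_derivative D) (at (\<theta>, q \<theta>, ddt a b q \<theta>))"
    and \<tau>: "(\<lambda>s. \<tau> s (q s)) differentiable (at \<theta> within {a..b})"
    and \<xi>: "(\<lambda>s. \<xi> s (q s)) differentiable (at \<theta> within {a..b})"
    and tr: "infinitesimal_transformation a b \<tau> \<xi> T X"
    and inv: "quasi_invariant a b \<alpha> t L \<Lambda> T X"
  defines "\<tau>' \<equiv> ddt a b (\<lambda>s. \<tau> s (q s)) \<theta>" and "\<xi>' \<equiv> ddt a b (\<lambda>s. \<xi> s (q s)) \<theta>"
  shows "D (\<tau> \<theta> (q \<theta>), \<xi> \<theta> (q \<theta>), \<xi>' - \<tau>' *\<^sub>R ddt a b q \<theta>)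
           + L \<theta> (q \<theta>) (ddt a b q \<theta>) * (\<tau>' + (1 - \<alpha>) / (t - \<theta>) * \<tau> \<theta> (q \<theta>))
         = ddt a b (\<lambda>s. \<Lambda> s (q s) (ddt a b q s)) \<theta>" (is "?lhs = ?\<Lambda>'")
proof -
  have \<theta>: "\<theta> \<in> {a..b}" "\<theta> \<noteq> t"
    using assms(2,3) by auto
  define w where "w = (t - \<theta>) powr (\<alpha> - 1)"
  define G where "G = (\<lambda>\<epsilon>. fractional_density \<alpha> t L (T q \<epsilon> \<theta>) (X q \<epsilon> \<theta>)
      (ddt a b (X q \<epsilon>) \<theta> /\<^sub>R ddt a b (T q \<epsilon>) \<theta>) * ddt a b (T q \<epsilon>) \<theta>)"
  let ?G0 = "fractional_density \<alpha> t L \<theta> (q \<theta>) (ddt a b q \<theta>)"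
  have "w \<noteq> 0"
    using \<theta> by (simp add: w_def)
  have T: "negligible_term a b (\<lambda>\<epsilon> s. T q \<epsilon> s - (s + \<epsilon> *\<^sub>R \<tau> s (q s)))"
    and X: "negligible_term a b (\<lambda>\<epsilon> s. X q \<epsilon> s - (q s + \<epsilon> *\<^sub>R \<xi> s (q s)))"
    using tr q unfolding infinitesimal_transformation_def by auto
  have id: "((\<lambda>s. s) has_vector_derivative 1) (at \<theta> within {a..b})"
    by (auto intro!: derivative_eq_intros)
  note dT = negligible_term_first_order[OF \<open>a < b\<close> T \<theta>(1) id \<tau>]
    and dX = negligible_term_first_order[OF \<open>a < b\<close> X \<theta>(1) C2_on_interval_velocity(1)[OF \<open>a < b\<close> q \<theta>(1)] \<xi>]
  have "(G(0 := ?G0) has_real_derivative w * ?lhs) (at 0)"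
    using transformed_density_has_derivative[OF D \<theta>(2) dT(1) _ dX(1) _ dT(2) _ dX(2), of \<alpha>]
    by (simp add: G_def w_def \<tau>'_def \<xi>'_def fun_upd_def if_distrib cong: if_cong)
  moreover have "(G(0 := ?G0) has_real_derivative w * ?\<Lambda>') (at 0)"
  proof -
    have "isCont ((\<lambda>\<epsilon>. T q \<epsilon> \<theta>)(0 := \<theta>)) 0"
      using dT(1) by (rule has_vector_derivative_continuous)
    then have "((\<lambda>\<epsilon>. T q \<epsilon> \<theta>) \<longlongrightarrow> \<theta>) (at 0)"
      unfolding isCont_def fun_upd_same
      by (rule Lim_transform_eventually) (simp_all add: eventually_at_filter)
    then have "\<forall>\<^sub>F \<epsilon> in at 0. T q \<epsilon> \<theta> \<in> {a<..<b}"
      using assms(2) by (intro topological_tendstoD) auto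
    then have ev: "\<forall>\<^sub>F \<epsilon> in at 0. T q \<epsilon> \<theta> \<in> {a..b}"
      by (rule eventually_mono) simp
    \<comment> \<open>At an interior time the restriction of \<open>\<epsilon>\<close> in the definition of quasi-invariance disappears.\<close>
    have "at 0 within {\<epsilon>. T q \<epsilon> \<theta> \<in> {a..b}} = at (0::real)" (is "at 0 within ?E = _")
    proof -
      have "?E - {0} = (UNIV - {0}) \<inter> ?E"
        by blast
      then have "at 0 within ?E = inf (at 0) (principal ?E)"
        unfolding at_within_def inf_assoc inf_principal by (rule arg_cong)
      also have "\<dots> = at 0"
        using ev by (intro inf_absorb1) (simp add: le_principal)
      finally show ?thesis .
    qed
    then have "(\<lambda>\<epsilon>. norm (G \<epsilon> - (?G0 + \<epsilon> *\<^sub>R (w * ?\<Lambda>')))) \<in> o[at 0](\<lambda>\<epsilon>. \<epsilon>)"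
      using inv[unfolded quasi_invariant_def, rule_format, OF q \<theta>(1)]
      by (simp add: G_def w_def mult.assoc)
    then show ?thesis
      unfolding has_real_derivative_iff_has_vector_derivative by (rule has_vector_derivative_of_smallo)
  qed
  ultimately have "w * ?lhs = w * ?\<Lambda>'"
    by (rule DERIV_unique)
  then show ?thesis
    using \<open>w \<noteq> 0\<close> by simp
qed

section \<open>The gauge term along extremals\<close>

text \<open>
  The function \<open>?N\<close> in the proof is zero along the curve, hence so is its derivative. Replacing the rate
  of change of the momentum by means of the Euler-Lagrange equation, the acceleration cancels, and
  what remains is the left-hand side of the first variation identity up to a multiple of \<open>?N\<close>.
\<close>
lemma gauge_rate_vanishes:
  fixes L :: "real \<Rightarrow> 'a::euclidean_space \<Rightarrow> 'a \<Rightarrow> real"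
  assumes "a < b" "\<theta> \<in> {a<..<b}" "t \<notin> {a..b}"
    and L: "C2_on ({a..b} \<times> UNIV \<times> UNIV) (\<lambda>(\<theta>, x, v). L \<theta> x v)"
    and el: "euler_lagrange_solution a b \<alpha> t L q"
    and \<tau>: "(\<lambda>s. \<tau> s (q s)) differentiable (at \<theta> within {a..b})"
    and \<xi>: "(\<lambda>s. \<xi> s (q s)) differentiable (at \<theta> within {a..b})"
    and tr: "infinitesimal_transformation a b \<tau> \<xi> T X"
    and inv: "quasi_invariant a b \<alpha> t L \<Lambda> T X"
    and cond: "\<And>s. s \<in> {a..b} \<Longrightarrow>
      L s (q s) (ddt a b q s) * \<tau> s (q s)
      = - (partial3 L s (q s) (ddt a b q s) \<bullet> (\<xi> s (q s) - \<tau> s (q s) *\<^sub>R ddt a b q s))"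
  shows "ddt a b (\<lambda>s. \<Lambda> s (q s) (ddt a b q s)) \<theta> = 0"
proof -
  have \<theta>: "\<theta> \<in> {a..b}" and at: "at \<theta> within {a..b} = at \<theta>"
    using assms(2) by (auto simp: at_within_Icc_at)
  have q: "C2_on {a..b} q"
    using el unfolding euler_lagrange_solution_def by blast
  define u where "u = ddt a b q"
  define p where "p = (\<lambda>s. partial3 L s (q s) (u s))"
  define \<tau>q where "\<tau>q = (\<lambda>s. \<tau> s (q s))"
  define \<xi>q where "\<xi>q = (\<lambda>s. \<xi> s (q s))"
  define k where "k = (1 - \<alpha>) / (t - \<theta>)"
  note vel = C2_on_interval_velocity[OF \<open>a < b\<close> q \<theta>, folded u_def]
  obtain D where D0: "((\<lambda>(\<theta>, x, v). L \<theta> x v) has_derivative D)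
      (at (\<theta>, q \<theta>, u \<theta>) within {a..b} \<times> UNIV \<times> UNIV)"
    using L \<theta> unfolding C2_on_def by blast
  have "at (\<theta>, q \<theta>, u \<theta>) within {a..b} \<times> UNIV \<times> UNIV = at (\<theta>, q \<theta>, u \<theta>)"
    using assms(2) by (intro at_within_interior) (simp add: interior_Times)
  with D0 have D: "((\<lambda>(\<theta>, x, v). L \<theta> x v) has_derivative D) (at (\<theta>, q \<theta>, u \<theta>))"
    by simp
  interpret D: bounded_linear D
    using D by (rule has_derivative_bounded_linear)
  define d where "d = D (1, 0, 0)"
  have D_split: "D (c, x, v) = c * d + partial2 L \<theta> (q \<theta>) (u \<theta>) \<bullet> x + p \<theta> \<bullet> v" for c x v
  proof -
    have "D (c, x, v) = D (c *\<^sub>R (1, 0, 0) + (0, x, 0) + (0, 0, v))"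
      by simp
    then show ?thesis
      unfolding D.add D.scaleR p_def d_def by (simp add: partial_inner[OF D0 \<theta>])
  qed
  define \<tau>' \<xi>' p' u' where "\<tau>' = ddt a b \<tau>q \<theta>" and "\<xi>' = ddt a b \<xi>q \<theta>"
    and "p' = ddt a b p \<theta>" and "u' = ddt a b u \<theta>"
  have "p differentiable (at \<theta> within {a..b})"
    unfolding p_def using vel
    by (intro momentum_differentiable_along_curve[OF L _ _ \<theta>]) (auto intro: differentiableI_vector)
  then have dp: "(p has_vector_derivative p') (at \<theta>)"
    unfolding p'_def using has_vector_derivative_ddt at by metis
  have d\<tau>: "(\<tau>q has_real_derivative \<tau>') (at \<theta>)"
    unfolding \<tau>'_def has_real_derivative_iff_has_vector_derivative
    using has_vector_derivative_ddt \<tau>[folded \<tau>q_def] at by metis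
  have d\<xi>: "(\<xi>q has_vector_derivative \<xi>') (at \<theta>)"
    unfolding \<xi>'_def using has_vector_derivative_ddt \<xi>[folded \<xi>q_def] at by metis
  have dq: "(q has_vector_derivative u \<theta>) (at \<theta>)"
    using vel(1) at by simp
  have du: "(u has_vector_derivative u') (at \<theta>)"
    unfolding u'_def using has_vector_derivative_ddt vel(2) at by metis
  have dL: "((\<lambda>s. L s (q s) (u s)) has_real_derivative D (1, u \<theta>, u')) (at \<theta>)"
  proof -
    have "((\<lambda>s. (s, q s, u s)) has_derivative (\<lambda>h. h *\<^sub>R (1, u \<theta>, u'))) (at \<theta>)"
      using dq du unfolding has_vector_derivative_def by (auto intro!: derivative_eq_intros)
    from has_derivative_compose[OF this D] show ?thesis
      by (simp add: D.scaleR has_field_derivative_def mult_commute_abs del: scaleR_Pair)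
  qed
  have p': "p' = partial2 L \<theta> (q \<theta>) (u \<theta>) - k *\<^sub>R p \<theta>"
    using el \<theta> unfolding euler_lagrange_solution_def p'_def p_def u_def k_def
    by (simp add: algebra_simps)
  let ?N = "\<lambda>s. L s (q s) (u s) * \<tau>q s + p s \<bullet> (\<xi>q s - \<tau>q s *\<^sub>R u s)"
  have "(?N has_real_derivative
      D (1, u \<theta>, u') * \<tau>q \<theta> + \<tau>' * L \<theta> (q \<theta>) (u \<theta>)
      + (p \<theta> \<bullet> (\<xi>' - (\<tau>q \<theta> *\<^sub>R u' + \<tau>' *\<^sub>R u \<theta>)) + p' \<bullet> (\<xi>q \<theta> - \<tau>q \<theta> *\<^sub>R u \<theta>))) (at \<theta>)"
    by (intro DERIV_add DERIV_mult dL d\<tau>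
        bounded_bilinear.has_vector_derivative[OF bounded_bilinear_inner, folded has_real_derivative_iff_has_vector_derivative]
        dp has_vector_derivative_diff d\<xi> has_vector_derivative_scaleR du)
  moreover have "(?N has_real_derivative 0) (at \<theta>)"
  proof (rule has_field_derivative_transform_within_open[OF DERIV_const[of 0]])
    show "\<theta> \<in> {a<..<b}"
      by fact
    show "0 = ?N s" if "s \<in> {a<..<b}" for s
      using cond[of s] that by (simp add: \<tau>q_def \<xi>q_def p_def u_def)
  qed simp
  ultimately have "D (1, u \<theta>, u') * \<tau>q \<theta> + \<tau>' * L \<theta> (q \<theta>) (u \<theta>)
      + (p \<theta> \<bullet> (\<xi>' - (\<tau>q \<theta> *\<^sub>R u' + \<tau>' *\<^sub>R u \<theta>)) + p' \<bullet> (\<xi>q \<theta> - \<tau>q \<theta> *\<^sub>R u \<theta>)) = 0"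
    by (rule DERIV_unique)
  \<comment> \<open>The terms carrying the factor \<open>k\<close>, one from the weight and one from the Euler-Lagrange
      equation, are matched by the condition once more; linear arithmetic needs it multiplied
      by \<open>k\<close>.\<close>
  moreover have "L \<theta> (q \<theta>) (u \<theta>) * \<tau>q \<theta> = - (p \<theta> \<bullet> (\<xi>q \<theta> - \<tau>q \<theta> *\<^sub>R u \<theta>))"
    using cond[OF \<theta>] by (simp add: \<tau>q_def \<xi>q_def p_def u_def)
  then have "k * (L \<theta> (q \<theta>) (u \<theta>) * \<tau>q \<theta>) = - (k * (p \<theta> \<bullet> (\<xi>q \<theta> - \<tau>q \<theta> *\<^sub>R u \<theta>)))"
    by simp
  ultimately have "D (\<tau>q \<theta>, \<xi>q \<theta>, \<xi>' - \<tau>' *\<^sub>R u \<theta>) + L \<theta> (q \<theta>) (u \<theta>) * (\<tau>' + k * \<tau>q \<theta>) = 0"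
    unfolding p' D_split by (simp add: algebra_simps)
  then show ?thesis
    using quasi_invariant_first_variation[OF assms(1-3) q D[unfolded u_def] \<tau> \<xi> tr inv]
    by (simp add: \<tau>q_def \<xi>q_def \<tau>'_def \<xi>'_def k_def u_def)
qed

theorem theorem5:
  fixes a b \<alpha> t :: real
    and L \<Lambda> :: "real \<Rightarrow> real ^ 'n \<Rightarrow> real ^ 'n \<Rightarrow> real"
    and \<tau> :: "real \<Rightarrow> real ^ 'n \<Rightarrow> real"
    and \<xi> :: "real \<Rightarrow> real ^ 'n \<Rightarrow> real ^ 'n"
    and T :: "(real \<Rightarrow> real ^ 'n) \<Rightarrow> real \<Rightarrow> real \<Rightarrow> real"
    and X :: "(real \<Rightarrow> real ^ 'n) \<Rightarrow> real \<Rightarrow> real \<Rightarrow> real ^ 'n"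
  assumes "a < b"
    and "0 < \<alpha>" and "\<alpha> \<le> 1"
    and "t \<notin> {a..b}"
    and "C2_on ({a..b} \<times> UNIV \<times> UNIV) (\<lambda>(\<theta>, x, v). L \<theta> x v)"
    and "\<And>q. C2_on {a..b} q \<Longrightarrow> (\<lambda>\<theta>. \<tau> \<theta> (q \<theta>)) differentiable_on {a..b}"
    and "\<And>q. C2_on {a..b} q \<Longrightarrow> (\<lambda>\<theta>. \<xi> \<theta> (q \<theta>)) differentiable_on {a..b}"
    and "\<And>q. C2_on {a..b} q \<Longrightarrow> (\<lambda>\<theta>. \<Lambda> \<theta> (q \<theta>) (ddt a b q \<theta>)) differentiable_on {a..b}"
    and "infinitesimal_transformation a b \<tau> \<xi> T X"
    and "quasi_invariant a b \<alpha> t L \<Lambda> T X"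
    and "\<And>\<theta> x v. \<theta> \<in> {a..b} \<Longrightarrow>
           L \<theta> x v * \<tau> \<theta> x = - (partial3 L \<theta> x v \<bullet> (\<xi> \<theta> x - \<tau> \<theta> x *\<^sub>R v))"
  shows "constant_of_motion a b \<alpha> t L
           (\<lambda>\<theta> x v. partial3 L \<theta> x v \<bullet> \<xi> \<theta> x
                      + (L \<theta> x v - partial3 L \<theta> x v \<bullet> v) * \<tau> \<theta> x
                      - \<Lambda> \<theta> x v)"
  unfolding constant_of_motion_def
proof (intro allI impI ballI)
  fix q \<theta>
  assume el: "euler_lagrange_solution a b \<alpha> t L q" and \<theta>: "\<theta> \<in> {a..b}"
  then have q: "C2_on {a..b} q"
    unfolding euler_lagrange_solution_def by blast
  define l where "l = (\<lambda>s. \<Lambda> s (q s) (ddt a b q s))"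
  have l: "l differentiable_on {a..b}"
    unfolding l_def using assms(8)[OF q] .
  have const: "l s = l a" if "s \<in> {a..b}" for s
  proof (rule DERIV_isconst2[OF \<open>a < b\<close>])
    show "continuous_on {a..b} l"
      using l by (rule differentiable_imp_continuous_on)
    fix r assume r: "a < r" "r < b"
    have "ddt a b l r = 0"
      unfolding l_def
    proof (rule gauge_rate_vanishes[OF assms(1) _ assms(4,5) el _ _ assms(9,10)])
      show "(\<lambda>s. \<tau> s (q s)) differentiable (at r within {a..b})"
        and "(\<lambda>s. \<xi> s (q s)) differentiable (at r within {a..b})"
        using assms(6,7)[OF q] r by (auto simp: differentiable_on_def)
    qed (use r assms(11) in auto)
    moreover have "(l has_vector_derivative ddt a b l r) (at r within {a..b})"
      using l r by (intro has_vector_derivative_ddt) (auto simp: differentiable_on_def)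
    ultimately show "(l has_real_derivative 0) (at r)"
      using r by (simp add: at_within_Icc_at has_real_derivative_iff_has_vector_derivative)
  qed (use that in auto)
  have C: "- l a = partial3 L s (q s) (ddt a b q s) \<bullet> \<xi> s (q s)
      + (L s (q s) (ddt a b q s) - partial3 L s (q s) (ddt a b q s) \<bullet> ddt a b q s) * \<tau> s (q s)
      - \<Lambda> s (q s) (ddt a b q s)" if "s \<in> {a..b}" for s
    using assms(11)[OF that, of "q s" "ddt a b q s"] const[OF that]
    by (simp add: l_def algebra_simps)
  show "((\<lambda>s. partial3 L s (q s) (ddt a b q s) \<bullet> \<xi> s (q s)
      + (L s (q s) (ddt a b q s) - partial3 L s (q s) (ddt a b q s) \<bullet> ddt a b q s) * \<tau> s (q s)
      - \<Lambda> s (q s) (ddt a b q s)) has_real_derivative 0) (at \<theta> within {a..b})"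
    by (rule has_field_derivative_transform_within[OF DERIV_const[of "- l a"] zero_less_one \<theta>])
      (rule C)
qed

end
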